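(* Let $a>1$ be real and let $p\in\mathbb{C}$ with $\Re(p)>0$. For $a=b$ and $p=q$, the integral representation $$\Phi_{p,q}(a,b;z) = (1+a)^p(1+b)^q\left(\frac{z}{1-z} + \frac{pz}{z-1}\int_0^\infty e^{-py} z^{j(y)}\,dy\right), \qquad j(y)=\lfloor\Delta^{-1}(e^y)\rfloor,\quad \Delta(y)=(y+a)(y+b)^{q/p},$$ of the generalized polylogarithm simplifies to the following form: $$\sum_{n=0}^\infty \frac{z^n}{(n+a)^p} = \frac{1}{a^p} + \frac{z}{1-z} + \frac{pz}{z-1}\int_0^\infty e^{-p\tau} z^{\lfloor e^\tau-a\rfloor}\,d\tau, \qquad |z|<1.$$
   Context: For $a,b>0$ and complex $p,q$ with $\Re(p)>0$, $\Re(q)>0$, the generalized polylogarithm is $$\Phi_{p,q}(a,b;z) = \sum_{k=1}^\infty \frac{(1+a)^p(1+b)^q}{(k+a)^p(k+b)^q} z^k, \qquad |z|<1.$$ The series $\sum_{n=0}^\infty z^n/(n+a)^p$ is the Lerch transcendent function. $\lfloor\cdot\rfloor$ denotes the greatest integer function.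
   Formalization: The exponent ⌊e^τ−a⌋ is replaced by 0 when negative (τ<ln a), and j(y) is 0 where e^y<Δ(0), since for a>1 the formula as written fails (for 1<a≤2, z≠0 it is off by a^{-p}−1); the representation is taken at p/2, p/2 to yield exponent p. *)

theory Defs
  imports "HOL-Analysis.Analysis"
begin

definition gen_polylog :: "complex \<Rightarrow> complex \<Rightarrow> real \<Rightarrow> real \<Rightarrow> complex \<Rightarrow> complex" where
  "gen_polylog p q a b z =
     (\<Sum>k. of_real (1 + a) powr p * of_real (1 + b) powr q
            / (of_real (real (Suc k) + a) powr p * of_real (real (Suc k) + b) powr q) * z ^ Suc k)"

definition lerch :: "complex \<Rightarrow> complex \<Rightarrow> real \<Rightarrow> complex" where
  "lerch z p a = (\<Sum>n. z ^ n / of_real (real n + a) powr p)"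

text \<open>Complex-valued because \<open>q / p\<close> may be non-real.\<close>

definition Delta :: "complex \<Rightarrow> complex \<Rightarrow> real \<Rightarrow> real \<Rightarrow> real \<Rightarrow> complex" where
  "Delta p q a b y = of_real (y + a) * of_real (y + b) powr (q / p)"

text \<open>
  The index \<open>j(y)\<close> is the number of terms of a partial sum over the \<open>k \<ge> 1\<close> with
  \<open>\<Delta>(k) \<le> e\<^sup>y\<close>. Here \<open>\<Delta>\<close> is regarded as a function on \<open>[0, \<infinity>)\<close>. For \<open>e\<^sup>y\<close> outside its range
  (such as \<open>e\<^sup>y < \<Delta>(0)\<close>, which does occur for \<open>y \<ge> 0\<close> when \<open>a\<close>, \<open>b\<close> are greater than 1)
  the inverse is undefined, the partial sum is empty, and the index is 0.
  For \<open>a = b\<close>, \<open>p = q\<close> one has \<open>\<Delta>(y) = (y + a)\<^sup>2\<close>, and with \<open>y = 2\<tau>\<close> the index becomes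
  \<open>nat \<lfloor>exp \<tau> - a\<rfloor>\<close>. The \<open>nat\<close> is essential when \<open>a > 1\<close>: with negative exponents on
  \<open>0 \<le> \<tau> < ln a\<close> the integral formula for the Lerch series would be false.
\<close>

definition jidx :: "complex \<Rightarrow> complex \<Rightarrow> real \<Rightarrow> real \<Rightarrow> real \<Rightarrow> nat" where
  "jidx p q a b y =
     (if of_real (exp y) \<in> Delta p q a b ` {0..}
      then nat \<lfloor>the_inv_into {0..} (Delta p q a b) (of_real (exp y))\<rfloor>
      else 0)"

definition gen_polylog_integral :: "complex \<Rightarrow> complex \<Rightarrow> real \<Rightarrow> real \<Rightarrow> complex \<Rightarrow> complex" where
  "gen_polylog_integral p q a b z =
     of_real (1 + a) powr p * of_real (1 + b) powr q *
       (z / (1 - z) + p * z / (z - 1) *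
          (LBINT y:{0..}. exp (- p * of_real y) * z ^ jidx p q a b y))"

end

theory Submission
  imports Defs "HOL-Real_Asymp.Real_Asymp"
begin

text \<open>
  Since \<open>\<integral>\<^bsub>ln c\<^esub>\<^sup>\<infinity> p e\<^bsup>-p t\<^esup> dt = c\<^bsup>-p\<^esup>\<close>, the series of \<open>z\<^sup>k (k + a)\<^bsup>-p\<^esup>\<close> over \<open>k \<ge> 1\<close> is a
  sum of tail integrals. Exchanging sum and integral leaves, at the point \<open>t\<close>, the geometric sum
  of the \<open>z\<^sup>k\<close> with \<open>1 \<le> k \<le> \<lfloor>e\<^sup>t - a\<rfloor>\<close>, that is \<open>z (1 - z\<^sup>N) / (1 - z)\<close> with
  \<open>N = nat \<lfloor>e\<^sup>t - a\<rfloor>\<close>. In the integral representation of the generalized polylogarithm the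
  substitution \<open>y = 2 t\<close> turns the index into the same \<open>N\<close>.
\<close>

section \<open>Tail integrals of the complex exponential\<close>

text \<open>The norm of the integrand is the positive real function \<open>exp (- Re p * t)\<close>,
  whose antiderivative tends to 0 at infinity; domination transfers integrability to the complex
  case.\<close>

lemma exp_tail_integrable:
  fixes p :: complex and c :: real
  assumes "Re p > 0"
  shows "set_integrable lborel {c..} (\<lambda>t. exp (- p * of_real t))"
proof -
  have lim: "((\<lambda>t. - exp (- Re p * t) / Re p) \<longlongrightarrow> 0) at_top"
    using assms by real_asymp
  have "set_integrable lborel (einterval c \<infinity>) (\<lambda>t. exp (- Re p * t))"
  proof (rule interval_integral_FTC_nonneg(1))
    show "((\<lambda>t. - exp (- Re p * t) / Re p) has_real_derivative exp (- Re p * t)) (at t)" for t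
      using assms by (auto intro!: derivative_eq_intros)
    have "isCont (\<lambda>t. - exp (- Re p * t) / Re p) c"
      using assms by (intro continuous_intros) auto
    then show "(((\<lambda>t. - exp (- Re p * t) / Re p) \<circ> real_of_ereal) \<longlongrightarrow> - exp (- Re p * c) / Re p)
        (at_right (ereal c))"
      by (auto simp: ereal_tendsto_simps isCont_def intro: filterlim_at_split[THEN iffD1, THEN conjunct2])
    show "(((\<lambda>t. - exp (- Re p * t) / Re p) \<circ> real_of_ereal) \<longlongrightarrow> 0) (at_left \<infinity>)"
      using lim by (simp add: ereal_tendsto_simps)
  qed (auto intro!: continuous_intros)
  \<comment> \<open>The fundamental theorem works on the open half-line; adding the endpoint
    \<open>c\<close> changes a null set only.\<close>
  then have "set_integrable lborel {c<..} (\<lambda>t. exp (- Re p * t))"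
    by simp
  then have int: "set_integrable lborel {c..} (\<lambda>t. exp (- Re p * t))"
    unfolding set_integrable_def
    by (rule integrable_cong_AE_imp)
       (use AE_lborel_singleton[of c] in \<open>auto elim!: eventually_mono simp: indicator_def\<close>)
  show ?thesis
    unfolding set_integrable_def
    by (rule Bochner_Integration.integrable_bound[OF int[unfolded set_integrable_def]])
       (auto simp: indicator_def norm_exp_eq_Re)
qed

lemma exp_tail_integral:
  fixes p :: complex and c :: real
  assumes "Re p > 0"
  shows "(LBINT t:{c..}. p * exp (- p * of_real t)) = exp (- p * of_real c)"
proof -
  have int: "set_integrable lborel {c..} (\<lambda>t. p * exp (- p * of_real t))"
    using exp_tail_integrable[OF assms] by simp
  have "((\<lambda>t. exp (- Re p * t)) \<longlongrightarrow> 0) at_top"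
    using assms by real_asymp
  then have lim: "((\<lambda>t. - exp (- p * of_real t)) \<longlongrightarrow> 0) at_top"
    by (intro tendsto_norm_zero_cancel[of "\<lambda>t. - exp (- p * of_real t)"]) (simp add: norm_exp_eq_Re)
  have "(LBINT t=ereal c..\<infinity>. p * exp (- p * of_real t)) = 0 - (- exp (- p * of_real c))"
  proof (rule interval_integral_FTC_integrable)
    show "((\<lambda>t. - exp (- p * of_real t)) has_vector_derivative p * exp (- p * of_real t)) (at t)" for t
      by (rule has_vector_derivative_real_field) (auto intro!: derivative_eq_intros)
    show "set_integrable lborel (einterval c \<infinity>) (\<lambda>t. p * exp (- p * of_real t))"
      by (rule set_integrable_subset[OF int]) auto
    have "isCont (\<lambda>t::real. - exp (- p * of_real t)) c"
      by (intro continuous_intros)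
    then show "(((\<lambda>t. - exp (- p * of_real t)) \<circ> real_of_ereal) \<longlongrightarrow> - exp (- p * of_real c))
        (at_right (ereal c))"
      by (auto simp: ereal_tendsto_simps isCont_def intro: filterlim_at_split[THEN iffD1, THEN conjunct2])
    show "(((\<lambda>t. - exp (- p * of_real t)) \<circ> real_of_ereal) \<longlongrightarrow> 0) (at_left \<infinity>)"
      using lim by (simp add: ereal_tendsto_simps)
  qed (auto intro!: continuous_intros)
  moreover have "(LBINT t:{c<..}. p * exp (- p * of_real t)) = (LBINT t:{c..}. p * exp (- p * of_real t))"
    unfolding set_lebesgue_integral_def
    by (rule integral_cong_AE)
       (use AE_lborel_singleton[of c] in \<open>auto elim!: eventually_mono simp: indicator_def\<close>)
  ultimately show ?thesis
    by (simp add: interval_integral_to_infinity_eq)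
qed

text \<open>Identifies each Lerch coefficient with the value of a tail integral that starts at
  \<open>ln c\<close>.\<close>

lemma inverse_powr_eq_exp:
  fixes p :: complex and c :: real
  assumes "c > 0"
  shows "1 / of_real c powr p = exp (- p * of_real (ln c))"
  using assms by (simp add: powr_def Ln_of_real exp_minus field_simps)

section \<open>Convergence of the series and of the integral\<close>

lemma summable_lerch:
  fixes p z :: complex and a :: real
  assumes "a > 0" "Re p > 0" "norm z < 1"
  shows "summable (\<lambda>n. z ^ n / of_real (real n + a) powr p)"
proof (rule summable_comparison_test')
  show "summable (\<lambda>n. norm z ^ n)"
    using assms by (simp add: summable_geometric)
  \<comment> \<open>The geometric bound starts at \<open>n = 1\<close>: for \<open>a < 1\<close> the
    denominator at \<open>n = 0\<close> has norm below 1.\<close>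
  fix n :: nat assume "n \<ge> 1"
  then have "real n + a \<ge> 1"
    using assms by linarith
  then have "(real n + a) powr Re p \<ge> 1" "norm (of_real (real n + a) powr p) = (real n + a) powr Re p"
    using assms by (auto simp: ge_one_powr_ge_zero norm_powr_real_powr simp del: of_real_add)
  then show "norm (z ^ n / of_real (real n + a) powr p) \<le> norm z ^ n"
    by (simp add: norm_divide norm_power divide_le_eq mult_le_cancel_left1 del: of_real_add)
qed

text \<open>The exponent is a natural number, so the power of \<open>z\<close> has norm at most 1
  and the exponential tail dominates.\<close>

lemma floor_power_integrable:
  fixes p z :: complex and a :: real
  assumes "Re p > 0" "norm z < 1"
  shows "set_integrable lborel {0..} (\<lambda>t. exp (- p * of_real t) * z ^ nat \<lfloor>exp t - a\<rfloor>)"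
proof -
  \<comment> \<open>The floor is measurable into the discrete space of integers, on which every
    function is measurable.\<close>
  have [measurable]: "(\<lambda>t::real. z ^ nat \<lfloor>exp t - a\<rfloor>) \<in> borel_measurable borel"
    by (rule measurable_compose[where g = "\<lambda>i. z ^ nat i" and N = "count_space UNIV"]) simp_all
  show ?thesis
    unfolding set_integrable_def
  proof (rule Bochner_Integration.integrable_bound)
    show "integrable lborel (\<lambda>t::real. indicator {0..} t *\<^sub>R exp (- p * of_real t))"
      using exp_tail_integrable[OF assms(1), of 0] by (simp add: set_integrable_def)
    show "AE t in lborel. norm (indicator {0..} t *\<^sub>R (exp (- p * of_real t) * z ^ nat \<lfloor>exp t - a\<rfloor>))
        \<le> norm (indicator {0..} t *\<^sub>R exp (- p * complex_of_real t))"
      using assms(2)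
      by (auto simp: norm_mult norm_power indicator_def power_le_one mult_left_le)
  qed measurable
qed

section \<open>Exchange of sum and integral\<close>

text \<open>Only finitely many of the tails contain a given \<open>t\<close>, so the series is a
  finite geometric sum. In the application \<open>w\<close> is
  \<open>p * exp (- p * t)\<close>.\<close>

lemma tail_terms_sums:
  fixes w z :: complex and a t :: real
  assumes "a > 0" "norm z < 1"
  shows "(\<lambda>k. indicator {ln (real (Suc k) + a)..} t *\<^sub>R (z ^ Suc k * w)) sums
     (indicator {0..} t *\<^sub>R (z / (1 - z) * w - z / (1 - z) * (w * z ^ nat \<lfloor>exp t - a\<rfloor>)))"
proof -
  define N where "N = nat \<lfloor>exp t - a\<rfloor>"
  have iff: "t \<ge> ln (real (Suc k) + a) \<longleftrightarrow> k < N" for k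
  proof -
    have "t \<ge> ln (real (Suc k) + a) \<longleftrightarrow> exp t \<ge> real (Suc k) + a"
      using assms(1) ln_ge_iff[of "real (Suc k) + a"] by (metis add_nonneg_pos exp_le_cancel_iff exp_ln of_nat_0_le_iff)
    also have "\<dots> \<longleftrightarrow> int (Suc k) \<le> \<lfloor>exp t - a\<rfloor>"
      by (simp add: le_floor_iff algebra_simps)
    \<comment> \<open>Truncation by \<open>nat\<close> is harmless: a negative floor admits no index
      \<open>Suc k\<close>, just as \<open>N = 0\<close> admits no \<open>k\<close>.\<close>
    also have "\<dots> \<longleftrightarrow> k < N"
      unfolding N_def by linarith
    finally show ?thesis .
  qed
  have z: "z \<noteq> 1"
    using assms(2) by auto
  have "(\<lambda>k. if k \<in> {..<N} then z ^ Suc k * w else 0) sums (\<Sum>k<N. z ^ Suc k * w)"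
    by (rule sums_If_finite_set) simp
  also have "(\<lambda>k. if k \<in> {..<N} then z ^ Suc k * w else 0) =
      (\<lambda>k. indicator {ln (real (Suc k) + a)..} t *\<^sub>R (z ^ Suc k * w))"
    using iff by (auto simp: indicator_def fun_eq_iff simp del: of_nat_Suc power_Suc)
  also have "(\<Sum>k<N. z ^ Suc k * w) = z * w * (\<Sum>k<N. z ^ k)"
    by (simp add: sum_distrib_left mult_ac)
  also have "\<dots> = z / (1 - z) * w - z / (1 - z) * (w * z ^ N)"
    using z by (simp add: sum_gp_strict diff_divide_distrib algebra_simps)
  \<comment> \<open>The indicator may be inserted because for \<open>t < 0\<close> one has
    \<open>N = 0\<close>, and the two terms cancel.\<close>
  also have "\<dots> = indicator {0..} t *\<^sub>R (z / (1 - z) * w - z / (1 - z) * (w * z ^ N))"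
  proof (cases "t \<ge> 0")
    case False
    then have "exp t - a < 1"
      using assms(1) exp_less_one_iff[of t] by linarith
    then have "N = 0"
      unfolding N_def by linarith
    then show ?thesis by simp
  qed simp
  finally show ?thesis
    unfolding N_def .
qed

lemma lerch_eq_integral:
  fixes p z :: complex and a :: real
  assumes a: "a > 0" and p: "Re p > 0" and z: "norm z < 1"
  shows "lerch z p a = 1 / of_real a powr p + z / (1 - z) + p * z / (z - 1) *
           (LBINT t:{0..}. exp (- p * of_real t) * z ^ nat \<lfloor>exp t - a\<rfloor>)"
proof -
  define e where "e t = p * exp (- p * complex_of_real t)" for t
  define g where "g t = exp (- p * complex_of_real t) * z ^ nat \<lfloor>exp t - a\<rfloor>" for t
  define f where "f k t = indicator {ln (real (Suc k) + a)..} t *\<^sub>R (z ^ Suc k * e t)" for k t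
  have e_int: "set_integrable lborel {c..} e" for c
    unfolding e_def by (rule set_integrable_mult_right) (rule exp_tail_integrable[OF p])
  have e_val: "(LBINT t:{c..}. e t) = exp (- p * of_real c)" for c
    unfolding e_def by (rule exp_tail_integral[OF p])
  have g_int: "set_integrable lborel {0..} g"
    unfolding g_def by (rule floor_power_integrable[OF p z])
  have f_int: "integrable lborel (f k)" for k
  proof -
    have "set_integrable lborel {ln (real (Suc k) + a)..} (\<lambda>t. z ^ Suc k * e t)"
      by (rule set_integrable_mult_right) (rule e_int)
    then show ?thesis
      unfolding f_def set_integrable_def .
  qed
  have f_val: "(\<integral>t. f k t \<partial>lborel) = z ^ Suc k / of_real (real (Suc k) + a) powr p" for k
  proof -
    have "(\<integral>t. f k t \<partial>lborel) = z ^ Suc k * (LBINT t:{ln (real (Suc k) + a)..}. e t)"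
      unfolding f_def set_lebesgue_integral_def[symmetric] by (rule set_integral_mult_right)
    also have "\<dots> = z ^ Suc k * (1 / of_real (real (Suc k) + a) powr p)"
      using a by (subst inverse_powr_eq_exp) (simp_all add: e_val)
    finally show ?thesis by simp
  qed
  \<comment> \<open>Every tail lies inside the half-line from 0, since \<open>Suc k + a\<close>
    exceeds 1. This one bound yields both the pointwise absolute summability and the summability of
    the L1 norms that the exchange requires.\<close>
  have norm_f: "norm (f k t) \<le> norm z ^ Suc k * norm (indicator {0..} t *\<^sub>R e t)" for k t
  proof -
    have "ln (real (Suc k) + a) \<ge> 0"
      using a by (intro ln_ge_zero) auto
    then show ?thesis
      by (auto simp: f_def indicator_def norm_mult norm_power)
  qed
  have geo: "summable (\<lambda>k. norm z ^ Suc k)"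
    using z by (subst summable_Suc_iff) (simp add: summable_geometric)
  have "(\<lambda>k. \<integral>t. f k t \<partial>lborel) sums (\<integral>t. (\<Sum>k. f k t) \<partial>lborel)"
  proof (rule sums_integral[OF f_int])
    have "summable (\<lambda>k. norm (f k t))" for t
      by (rule summable_comparison_test'[OF summable_mult2[OF geo, of "norm (indicator {0..} t *\<^sub>R e t)"], of 0])
         (use norm_f in simp)
    then show "AE t in lborel. summable (\<lambda>k. norm (f k t))"
      by simp
    have "(\<integral>t. norm (f k t) \<partial>lborel) \<le> norm z ^ Suc k * (\<integral>t. norm (indicator {0..} t *\<^sub>R e t) \<partial>lborel)" for k
    proof -
      have "(\<integral>t. norm (f k t) \<partial>lborel) \<le> (\<integral>t. norm z ^ Suc k * norm (indicator {0..} t *\<^sub>R e t) \<partial>lborel)"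
        using e_int[of 0, unfolded set_integrable_def]
        by (intro integral_mono f_int integrable_norm norm_f integrable_mult_right) auto
      then show ?thesis by simp
    qed
    then show "summable (\<lambda>k. \<integral>t. norm (f k t) \<partial>lborel)"
      by (intro summable_comparison_test'[OF summable_mult2[OF geo], of 0]) simp
  qed
  also have "(\<lambda>t. \<Sum>k. f k t) =
      (\<lambda>t. indicator {0..} t *\<^sub>R (z / (1 - z) * e t - z / (1 - z) * p * g t))"
  proof
    show "(\<Sum>k. f k t) = indicator {0..} t *\<^sub>R (z / (1 - z) * e t - z / (1 - z) * p * g t)" for t
      using tail_terms_sums[OF a z, of t "e t", THEN sums_unique, symmetric]
      unfolding f_def by (simp only: e_def g_def mult.assoc)
  qed
  also have "(\<integral>t. indicator {0..} t *\<^sub>R (z / (1 - z) * e t - z / (1 - z) * p * g t) \<partial>lborel)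
      = z / (1 - z) * (LBINT t:{0..}. e t) - z / (1 - z) * p * (LBINT t:{0..}. g t)"
    unfolding set_lebesgue_integral_def[symmetric]
    using e_int[of 0] g_int by (subst set_integral_diff) auto
  \<comment> \<open>The tail integral from 0 has the value \<open>exp 0 = 1\<close>.\<close>
  also have "\<dots> = z / (1 - z) - z / (1 - z) * p * (LBINT t:{0..}. g t)"
    by (simp add: e_val)
  also have "\<dots> = z / (1 - z) + p * z / (z - 1) * (LBINT t:{0..}. g t)"
    using z by (auto simp: divide_simps) (auto simp: algebra_simps)
  finally have "(\<Sum>k. z ^ Suc k / of_real (real (Suc k) + a) powr p) = 
      z / (1 - z) + p * z / (z - 1) * (LBINT t:{0..}. g t)"
    by (simp add: f_val sums_iff)
  moreover have "lerch z p a = (\<Sum>k. z ^ Suc k / of_real (real (Suc k) + a) powr p) + 1 / of_real a powr p"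
    using suminf_split_head[OF summable_lerch[OF a p z]] by (simp add: lerch_def)
  ultimately show ?thesis
    by (simp add: g_def)
qed

section \<open>The generalized polylogarithm with equal parameters\<close>

text \<open>Two equal factors with exponent \<open>p / 2\<close> multiply to one with exponent
  \<open>p\<close>. The polylogarithm starts at \<open>k = 1\<close>, hence the subtracted head of
  the Lerch series.\<close>

lemma gen_polylog_diagonal:
  fixes p z :: complex and a :: real
  assumes a: "a > 0" and p: "Re p > 0" and z: "norm z < 1"
  shows "gen_polylog (p / 2) (p / 2) a a z
           = of_real (1 + a) powr p * (lerch z p a - 1 / of_real a powr p)"
proof -
  have halves: "w powr (p / 2) * w powr (p / 2) = w powr p" for w :: complex
    by (simp add: powr_add[symmetric])
  have summ: "summable (\<lambda>k. z ^ Suc k / of_real (real (Suc k) + a) powr p)"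
    by (subst summable_Suc_iff) (rule summable_lerch[OF assms])
  have "gen_polylog (p / 2) (p / 2) a a z
      = (\<Sum>k. of_real (1 + a) powr p * (z ^ Suc k / of_real (real (Suc k) + a) powr p))"
    unfolding gen_polylog_def halves by simp
  also have "\<dots> = of_real (1 + a) powr p * (\<Sum>k. z ^ Suc k / of_real (real (Suc k) + a) powr p)"
    by (rule suminf_mult[OF summ])
  also have "(\<Sum>k. z ^ Suc k / of_real (real (Suc k) + a) powr p) = lerch z p a - 1 / of_real a powr p"
    using suminf_split_head[OF summable_lerch[OF assms]] by (simp add: lerch_def)
  finally show ?thesis .
qed

text \<open>Equal exponents make \<open>Delta\<close> the square of \<open>y + a\<close>, and
  \<open>exp (2 * t)\<close> is the square of \<open>exp t\<close>; with both bases nonnegative,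
  inverting \<open>Delta\<close> is taking a square root.\<close>

lemma jidx_diagonal:
  fixes q :: complex and a t :: real
  assumes q: "q \<noteq> 0" and a: "a > 0"
  shows "jidx q q a a (2 * t) = nat \<lfloor>exp t - a\<rfloor>"
proof -
  have Delta: "Delta q q a a y = of_real ((y + a)\<^sup>2)" if "y \<ge> 0" for y
    using q by (simp add: Delta_def power2_eq_square)
  have eq_iff: "Delta q q a a y = of_real (exp (2 * t)) \<longleftrightarrow> y = exp t - a" if "y \<ge> 0" for y
  proof -
    have "Delta q q a a y = of_real (exp (2 * t)) \<longleftrightarrow> (y + a)\<^sup>2 = (exp t)\<^sup>2"
      unfolding Delta[OF that] of_real_eq_iff by (simp add: exp_double)
    also have "\<dots> \<longleftrightarrow> y + a = exp t"
      using a that by (intro power2_eq_iff_nonneg) auto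
    finally show ?thesis by auto
  qed
  have inj: "inj_on (Delta q q a a) {0..}"
  proof (rule inj_onI)
    fix x y assume *: "x \<in> {0..}" "y \<in> {0..}" "Delta q q a a x = Delta q q a a y"
    then have "(x + a)\<^sup>2 = (y + a)\<^sup>2"
      by (simp only: Delta atLeast_iff of_real_eq_iff)
    then show "x = y"
      using * a by (simp add: power2_eq_iff_nonneg)
  qed
  show ?thesis
  proof (cases "exp t \<ge> a")
    case True
    then have D: "Delta q q a a (exp t - a) = of_real (exp (2 * t))" "exp t - a \<in> {0..}"
      using eq_iff by auto
    then show ?thesis
      unfolding jidx_def using the_inv_into_f_eq[OF inj D] imageI[OF D(2), of "Delta q q a a"]
      by simp
  \<comment> \<open>Here \<open>exp (2 * t)\<close> is outside the range of \<open>Delta\<close>;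
    the default index 0 agrees with \<open>nat\<close> of a negative floor.\<close>
  next
    case False
    then have "of_real (exp (2 * t)) \<notin> Delta q q a a ` {0..}"
      using eq_iff by force
    then show ?thesis
      using False by (simp add: jidx_def)
  qed
qed

text \<open>Substitution \<open>y = 2 * t\<close>: its Jacobian 2 turns the prefactor
  \<open>p / 2\<close> into \<open>p\<close>.\<close>

lemma gen_polylog_integral_diagonal:
  fixes p z :: complex and a :: real
  assumes a: "a > 0" and p: "p \<noteq> 0"
  shows "gen_polylog_integral (p / 2) (p / 2) a a z
           = of_real (1 + a) powr p *
             (z / (1 - z) + p * z / (z - 1) *
                (LBINT t:{0..}. exp (- p * of_real t) * z ^ nat \<lfloor>exp t - a\<rfloor>))"
proof -
  have halves: "w powr (p / 2) * w powr (p / 2) = w powr p" for w :: complex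
    by (simp add: powr_add[symmetric])
  have "(LBINT y:{0..}. exp (- (p / 2) * of_real y) * z ^ jidx (p / 2) (p / 2) a a y)
     = \<bar>2\<bar> *\<^sub>R (\<integral>t. indicator {0..} (0 + 2 * t) *\<^sub>R
         (exp (- (p / 2) * of_real (0 + 2 * t)) * z ^ jidx (p / 2) (p / 2) a a (0 + 2 * t)) \<partial>lborel)"
    unfolding set_lebesgue_integral_def by (rule lborel_integral_real_affine) simp
  also have "\<dots> = 2 * (LBINT t:{0..}. exp (- p * of_real t) * z ^ nat \<lfloor>exp t - a\<rfloor>)"
    using p a by (simp add: set_lebesgue_integral_def jidx_diagonal indicator_def scaleR_conv_of_real)
  finally have "(LBINT y:{0..}. exp (- (p / 2) * of_real y) * z ^ jidx (p / 2) (p / 2) a a y)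
     = 2 * (LBINT t:{0..}. exp (- p * of_real t) * z ^ nat \<lfloor>exp t - a\<rfloor>)" .
  moreover have "p / 2 * z / (z - 1) * (2 * I) = p * z / (z - 1) * I" for I
    by (auto simp: divide_simps algebra_simps)
  ultimately show ?thesis
    unfolding gen_polylog_integral_def halves by (simp only:)
qed

text \<open>Both exponents are \<open>p / 2\<close>, so that the Lerch exponent is \<open>p\<close>.
  The summability and integrability clauses ensure that the sum and the integral are genuine values
  and not defaults.\<close>

theorem corollary3p2:
  fixes a :: real and p z :: complex
  assumes "a > 1" and "Re p > 0" and "norm z < 1"
  shows "gen_polylog (p / 2) (p / 2) a a z
           = of_real (1 + a) powr p * (lerch z p a - 1 / of_real a powr p)
       \<and> gen_polylog_integral (p / 2) (p / 2) a a z
           = of_real (1 + a) powr p *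
             (z / (1 - z) + p * z / (z - 1) *
                (LBINT t:{0..}. exp (- p * of_real t) * z ^ nat \<lfloor>exp t - a\<rfloor>))
       \<and> summable (\<lambda>n. z ^ n / of_real (real n + a) powr p)
       \<and> set_integrable lborel {0..} (\<lambda>t. exp (- p * of_real t) * z ^ nat \<lfloor>exp t - a\<rfloor>)
       \<and> lerch z p a
           = 1 / of_real a powr p + z / (1 - z) + p * z / (z - 1) *
               (LBINT t:{0..}. exp (- p * of_real t) * z ^ nat \<lfloor>exp t - a\<rfloor>)"
proof -
  have a: "a > 0" and p: "p \<noteq> 0"
    using assms by auto
  show ?thesis
    by (intro conjI gen_polylog_diagonal[OF a assms(2,3)] gen_polylog_integral_diagonal[OF a p]
        summable_lerch[OF a assms(2,3)] floor_power_integrable[OF assms(2,3)]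
        lerch_eq_integral[OF a assms(2,3)])
qed

end
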